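(* Let $\boldsymbol{u}=(u_1,\dots,u_n)$ be a weakly increasing vector of positive integers, and let $L$ be a subset of the set of entries of $\boldsymbol{u}$ that is the set of lucky spots of some $\boldsymbol{u}$-parking function. Let $\delta_{\boldsymbol{u},L}=(\delta_1,\ldots,\delta_k)$ be the associated composition of $n$. Then the number of outcomes of $\boldsymbol{u}$-parking functions whose set of lucky spots is $L$ is $$\binom{n}{\delta_{\boldsymbol{u},L}}=\binom{n}{\delta_1,\ldots,\delta_k}=\frac{n!}{\delta_1!\,\delta_2!\cdots\delta_k!}.$$
   Context: Notation: $\mathbb{N}=\{1,2,\dots\}$. For a weakly increasing vector $\boldsymbol{u}=(u_1,\dots,u_n)$ of positive integers, spot $i\in\mathbb{N}$ on a one-way street has capacity $m_i(\boldsymbol{u})$, the number of times $i$ occurs in $\boldsymbol{u}$; a spot with capacity $0$ is unavailable. Cars $1,\dots,n$ enter in this order with preferences $\boldsymbol{a}=(a_1,\dots,a_n)\in\mathbb{N}^n$; car $c$ parks in the first spot $j\ge a_c$ in which fewer than $m_j(\boldsymbol{u})$ cars are already parked, and fails to park if there is none. $\boldsymbol{a}$ is a $\boldsymbol{u}$-parking function if all cars park. Its outcome is $B_1B_2\cdots B_M$ with $M=\max(\boldsymbol{u})$, where $B_i$ is the set of cars parked in spot $i$ if $m_i(\boldsymbol{u})>0$, and $B_i=\mathtt{X}$ if $m_i(\boldsymbol{u})=0$. A car is lucky if it parks in its preferred spot. A spot $\ell$ is a lucky spot of $\boldsymbol{a}$ if it is the preference of a lucky car, i.e. at least one lucky car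 parks in spot $\ell$ (other, unlucky, cars may also park there). Associated composition: given $\boldsymbol{u}$ and a subset $L$ of its entries, place bars in the word $u_1u_2\cdots u_n$ as follows. (1) Place a bar to the left of the first entry $u_1$. (2) For every $i\in\{1,\dots,\max(\boldsymbol{u})\}$ such that $i$ occurs in $\boldsymbol{u}$ but $i+1$ does not, place a bar to the right of (the last occurrence of) $i$. (3) For each $\ell\in L$ with $\ell>1$, place a bar to the left of the first occurrence of $\ell$ in $\boldsymbol{u}$. Bars placed at the same position by different rules are all kept. Let $k$ be the number of maximal contiguous blocks of unavailable spots in $\{1,\dots,\max(\boldsymbol{u})\}$ plus $|L|$. For $1\le i\le k$, $\delta_i$ is the number of entries of $\boldsymbol{u}$ between the $i$th and $(i+1)$th bars (counted left to right). Then $\delta_{\boldsymbol{u},L}=(\delta_1,\dots,\delta_k)$ is a weak composition of $n$. For example, $\boldsymbol{u}=(1,1,2,4,4,5)$ with $L=\{1,4\}$ gives $|\,112\,|\,|\,445\,|$ and $\delta_{\boldsymbol{u},L}=(3,0,3)$. *)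

theory Defs
  imports Complex_Main "HOL-Library.Multiset"
begin

text \<open>
  Spot \<open>i\<close> has capacity \<open>count_list u i\<close>. Cars and spots are
  numbered from 1, lists are indexed from 0: the preference of car \<open>c\<close> is \<open>a ! (c - 1)\<close>.
\<close>

text \<open>
  \<open>ps\<close> records where the earlier cars went, in order of arrival (\<open>None\<close> for a car that failed
  to park); \<open>p\<close> is the preference of the car now entering.
\<close>
definition first_spot :: "nat list \<Rightarrow> nat option list \<Rightarrow> nat \<Rightarrow> nat option" where
  "first_spot u ps p =
     (if \<exists>j\<ge>p. count_list ps (Some j) < count_list u j
      then Some (LEAST j. j \<ge> p \<and> count_list ps (Some j) < count_list u j)
      else None)"

definition parking :: "nat list \<Rightarrow> nat list \<Rightarrow> nat option list" where
  "parking u a = foldl (\<lambda>ps p. ps @ [first_spot u ps p]) [] a"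

definition spot_of :: "nat list \<Rightarrow> nat list \<Rightarrow> nat \<Rightarrow> nat option" where
  "spot_of u a c = parking u a ! (c - 1)"

definition is_parking_function :: "nat list \<Rightarrow> nat list \<Rightarrow> bool" where
  "is_parking_function u a \<longleftrightarrow>
     length a = length u \<and> (\<forall>p\<in>set a. p \<ge> 1) \<and>
     (\<forall>c\<in>{1..length u}. spot_of u a c \<noteq> None)"

text \<open>The entry \<open>None\<close> stands for the symbol \<open>X\<close> of an unavailable spot.\<close>
definition outcome :: "nat list \<Rightarrow> nat list \<Rightarrow> nat set option list" where
  "outcome u a =
     map (\<lambda>i. if count_list u i > 0
              then Some {c \<in> {1..length u}. spot_of u a c = Some i} else None)
       [1..<Suc (Max (set u))]"

definition lucky_car :: "nat list \<Rightarrow> nat list \<Rightarrow> nat \<Rightarrow> bool" where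
  "lucky_car u a c \<longleftrightarrow> spot_of u a c = Some (a ! (c - 1))"

definition lucky_spots :: "nat list \<Rightarrow> nat list \<Rightarrow> nat set" where
  "lucky_spots u a = {a ! (c - 1) | c. c \<in> {1..length u} \<and> lucky_car u a c}"

definition unavailable_interval :: "nat list \<Rightarrow> nat set \<Rightarrow> bool" where
  "unavailable_interval u B \<longleftrightarrow>
     (\<exists>i j. 1 \<le> i \<and> i \<le> j \<and> j \<le> Max (set u) \<and> B = {i..j}) \<and> (\<forall>s\<in>B. count_list u s = 0)"

definition unavailable_blocks :: "nat list \<Rightarrow> nat set set" where
  "unavailable_blocks u =
     {B. unavailable_interval u B \<and> (\<forall>B'. unavailable_interval u B' \<and> B \<subseteq> B' \<longrightarrow> B' = B)}"

text \<open>
  A bar is represented by the number of entries of \<open>u\<close> to its left. Bars at the same position are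
  kept with multiplicity, hence a multiset. The three summands are the three placement rules.
\<close>
definition bars :: "nat list \<Rightarrow> nat set \<Rightarrow> nat multiset" where
  "bars u L =
     {#0#}
     + image_mset (\<lambda>i. Suc (GREATEST j. j < length u \<and> u ! j = i))
         (mset_set {i \<in> {1..Max (set u)}. i \<in> set u \<and> Suc i \<notin> set u})
     + image_mset (\<lambda>l. LEAST j. j < length u \<and> u ! j = l) (mset_set {l \<in> L. l > 1})"

definition num_parts :: "nat list \<Rightarrow> nat set \<Rightarrow> nat" where
  "num_parts u L = card (unavailable_blocks u) + card L"

text \<open>
  If \<open>L\<close> is the set of lucky spots of a parking function, there are exactly
  \<open>num_parts u L + 1\<close> bars, so both list accesses below are in range.
\<close>
definition assoc_composition :: "nat list \<Rightarrow> nat set \<Rightarrow> nat list" where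
  "assoc_composition u L =
     (let bs = sorted_list_of_multiset (bars u L)
      in map (\<lambda>i. bs ! Suc i - bs ! i) [0..<num_parts u L])"

end

theory Submission
  imports Defs "HOL-Combinatorics.Multiset_Permutations"
begin

text \<open>
  Record an outcome by its word \<open>w\<close>, whose letter \<open>w ! c\<close> is the spot in which the car at index \<open>c\<close>
  (car \<open>c + 1\<close>) parks. If all cars park, every spot is filled to capacity, so \<open>w\<close> is a
  rearrangement of \<open>u\<close>. A spot \<open>l \<notin> L\<close> holds no lucky car; each car in it preferred a smaller spot
  and therefore found spot \<open>l - 1\<close> full. If \<open>l - 1\<close> is unavailable, it is always full and this says
  nothing; otherwise all cars of spot \<open>l - 1\<close> come before all cars of spot \<open>l\<close>. Conversely, this
  precedence condition suffices: let a car that should park in \<open>l\<close> prefer \<open>l\<close> if \<open>l \<in> L\<close> and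
  \<open>l - 1\<close> otherwise. Spot \<open>1\<close> can only be filled by lucky cars, so \<open>1\<close> belongs to \<open>L\<close> as soon as it
  is available. Hence the outcomes correspond to the words called \<open>admissible\<close> below
  (\<open>card_outcomes_eq_card_admissible\<close>).

  Two available neighbouring spots \<open>l - 1\<close> and \<open>l\<close> are separated by a bar exactly if \<open>l \<in> L\<close>, and there
  is always a bar where \<open>u\<close> skips a value. So the letters between two consecutive bars are
  consecutive integers linked by the precedence condition, and a word is admissible iff its letters
  from each such class appear in weakly increasing order (\<open>admissible_iff_sorted_classes\<close>). Such a word is
  determined by the sequence of the classes of its letters, which can be any rearrangement of the
  classes of the letters of \<open>u\<close> (\<open>card_words_sorted_on_classes\<close>). These rearrangements are counted
  by the multinomial coefficient of the class sizes, and the class sizes are the gaps between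
  consecutive bars; an empty gap contributes the factor \<open>0! = 1\<close>.

  All gaps are listed because there is exactly one bar more than \<open>num_parts u L\<close> (\<open>size_bars\<close>).
  Apart from the bar at the left end, each occurring value below the maximum whose successor does
  not occur gives one bar and starts one unavailable block, and each element of \<open>L\<close> other than \<open>1\<close>
  gives one bar. The remaining bar, to the right of the maximum, is matched by the element
  \<open>1\<close> of \<open>L\<close> if \<open>1\<close> occurs in \<open>u\<close>, and by the unavailable block that starts at spot \<open>1\<close> if it does not.
\<close>

section \<open>Words whose letters are sorted within each class\<close>

lemma sorted_filter_iff_nth:
  fixes w :: "'a::linorder list"
  shows "sorted (filter P w) \<longleftrightarrow>
    (\<forall>q<length w. \<forall>p<q. P (w ! p) \<longrightarrow> P (w ! q) \<longrightarrow> w ! p \<le> w ! q)"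
proof (induction w)
  case Nil
  then show ?case by simp
next
  case (Cons x w)
  have "(\<forall>q<length (x # w). \<forall>p<q. P ((x # w) ! p) \<longrightarrow> P ((x # w) ! q) \<longrightarrow> (x # w) ! p \<le> (x # w) ! q)
    \<longleftrightarrow> (\<forall>q<length w. P x \<longrightarrow> P (w ! q) \<longrightarrow> x \<le> w ! q) \<and>
        (\<forall>q<length w. \<forall>p<q. P (w ! p) \<longrightarrow> P (w ! q) \<longrightarrow> w ! p \<le> w ! q)"
    by (simp add: All_less_Suc2) blast
  moreover have "(\<forall>q<length w. P x \<longrightarrow> P (w ! q) \<longrightarrow> x \<le> w ! q) \<longleftrightarrow> (P x \<longrightarrow> (\<forall>y\<in>set w. P y \<longrightarrow> x \<le> y))"
    by (metis in_set_conv_nth)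
  ultimately show ?case
    using Cons.IH by auto
qed

text \<open>
  By induction from the left: the first letters have the same class, hence both are the first
  letter of the common subword of that class.
\<close>
lemma word_eqI_classes:
  assumes "map g w = map g w'" and "\<And>x. filter (\<lambda>y. g y = x) w = filter (\<lambda>y. g y = x) w'"
  shows "w = w'"
  using assms
proof (induction w arbitrary: w')
  case Nil
  then show ?case by simp
next
  case (Cons a w)
  then obtain b v where w': "w' = b # v" and gab: "g a = g b" and m: "map g w = map g v"
    by (cases w') auto
  have "filter (\<lambda>y. g y = g a) (a # w) = filter (\<lambda>y. g y = g a) (b # v)"
    using Cons.prems(2) w' by blast
  then have "a = b"
    using gab by simp
  moreover have "filter (\<lambda>y. g y = x) w = filter (\<lambda>y. g y = x) v" for x
    using Cons.prems(2)[of x] w' \<open>a = b\<close> by (cases "g a = x") auto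
  ultimately show ?case
    using Cons.IH[OF m] w' by simp
qed

text \<open>Each letter \<open>x\<close> of the class word takes the next letter from the queue of the class \<open>x\<close>.\<close>
fun deal :: "'b list \<Rightarrow> ('b \<Rightarrow> 'a list) \<Rightarrow> 'a list" where
  "deal [] q = []"
| "deal (x # v) q = hd (q x) # deal v (q(x := tl (q x)))"

lemma deal_classes:
  assumes "\<And>x. length (q x) = count_list v x" and "\<And>x y. y \<in> set (q x) \<Longrightarrow> g y = x"
  shows "map g (deal v q) = v \<and> filter (\<lambda>y. g y = x) (deal v q) = q x"
  using assms
proof (induction v arbitrary: q x)
  case Nil
  then show ?case by simp
next
  case (Cons z v)
  define q' where "q' = q(z := tl (q z))"
  have "length (q z) = Suc (count_list v z)"
    using Cons.prems(1)[of z] by simp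
  then have qz: "q z = hd (q z) # q' z"
    unfolding q'_def by (cases "q z") auto
  have len: "length (q' y) = count_list v y" for y
    using Cons.prems(1)[of y] by (auto simp: q'_def)
  have cls: "g y = x" if "y \<in> set (q' x)" for x y
    using that Cons.prems(2)[of y x] qz unfolding q'_def
    by (metis fun_upd_apply list.set_intros(2))
  have IH: "map g (deal v q') = v \<and> filter (\<lambda>y. g y = x) (deal v q') = q' x" for x
    using Cons.IH[OF len cls] .
  have gh: "g (hd (q z)) = z"
    using Cons.prems(2)[of "hd (q z)" z] qz by (metis list.set_intros(1))
  have "q' x = q x" if "x \<noteq> z"
    using that by (simp add: q'_def)
  then show ?case
    using IH gh qz by (auto simp: q'_def[symmetric])
qed

lemma count_eq_count_filter: "count_list w y = count_list (filter (\<lambda>z. g z = g y) w) y"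
  by (induction w) auto

text \<open>
  Passing from a word to the sequence of the classes of its letters is a bijection. In a word on the
  left, the subword of each class has a prescribed content and is sorted, so it is known;
  the class word then says how to interleave the subwords, and \<open>deal\<close> performs this interleaving.
\<close>
theorem card_words_sorted_on_classes:
  fixes u :: "'a::linorder list" and g :: "'a \<Rightarrow> 'b"
  shows "card {w. mset w = mset u \<and> (\<forall>x. sorted (filter (\<lambda>y. g y = x) w))}
    = card (permutations_of_multiset (image_mset g (mset u)))"
proof -
  let ?W = "{w. mset w = mset u \<and> (\<forall>x. sorted (filter (\<lambda>y. g y = x) w))}"
  let ?Q = "\<lambda>x. sort (filter (\<lambda>y. g y = x) u)"
  have pieces: "filter (\<lambda>y. g y = x) w = ?Q x" if "w \<in> ?W" for w x
    using that by (intro properties_for_sort[symmetric]) auto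
  have "bij_betw (map g) ?W (permutations_of_multiset (image_mset g (mset u)))"
  proof (rule bij_betwI')
    fix w w' assume w: "w \<in> ?W" "w' \<in> ?W"
    have "filter (\<lambda>y. g y = x) w = filter (\<lambda>y. g y = x) w'" for x
      using pieces[OF w(1)] pieces[OF w(2)] by (rule trans[OF _ sym])
    then show "map g w = map g w' \<longleftrightarrow> w = w'"
      using word_eqI_classes[of g w w'] by blast
  next
    fix w assume "w \<in> ?W"
    then show "map g w \<in> permutations_of_multiset (image_mset g (mset u))"
      by (auto simp: permutations_of_multiset_def)
  next
    fix v assume "v \<in> permutations_of_multiset (image_mset g (mset u))"
    then have v: "mset v = mset (map g u)"
      by (simp add: permutations_of_multiset_def)
    have len: "length (?Q x) = count_list v x" for x
    proof -
      have "count_list v x = count_list (map g u) x"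
        using v by (metis count_mset)
      also have "\<dots> = length (?Q x)"
        by (induction u) auto
      finally show ?thesis ..
    qed
    have cls: "g y = x" if "y \<in> set (?Q x)" for x y
      using that by simp
    let ?w = "deal v ?Q"
    have w: "map g ?w = v" "filter (\<lambda>y. g y = x) ?w = ?Q x" for x
      using deal_classes[of ?Q v g x, OF len cls] by auto
    have "mset ?w = mset u"
    proof (rule multiset_eqI)
      fix y
      have "count_list ?w y = count_list (?Q (g y)) y"
        by (subst count_eq_count_filter[where g = g]) (simp only: w)
      also have "\<dots> = count_list (filter (\<lambda>z. g z = g y) u) y"
        by (simp flip: count_mset)
      also have "\<dots> = count_list u y"
        by (rule count_eq_count_filter[symmetric])
      finally show "count (mset ?w) y = count (mset u) y"
        by (simp add: count_mset)
    qed
    then have "?w \<in> ?W"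
      using w(2) by simp
    then show "\<exists>w\<in>?W. v = map g w"
      by (intro bexI[where x = ?w] w(1)[symmetric])
  qed
  then show ?thesis
    by (rule bij_betw_same_card)
qed

section \<open>Outcomes as words\<close>

lemma first_spot_eq_Some_iff:
  "first_spot u ps p = Some j \<longleftrightarrow> p \<le> j \<and> count_list ps (Some j) < count_list u j \<and>
     (\<forall>i. p \<le> i \<and> i < j \<longrightarrow> count_list u i \<le> count_list ps (Some i))"
  (is "_ \<longleftrightarrow> ?R")
proof
  let ?P = "\<lambda>j. p \<le> j \<and> count_list ps (Some j) < count_list u j"
  assume "first_spot u ps p = Some j"
  then have ex: "\<exists>j. ?P j" and j: "j = (LEAST j. ?P j)"
    unfolding first_spot_def by (auto split: if_splits)
  have "?P j"
    unfolding j using ex by (rule LeastI_ex)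
  moreover have "count_list u i \<le> count_list ps (Some i)" if "p \<le> i" "i < j" for i
    using not_less_Least[of i ?P] that j by auto
  ultimately show ?R by blast
next
  assume R: ?R
  have "(LEAST j. p \<le> j \<and> count_list ps (Some j) < count_list u j) = j"
  proof (rule Least_equality)
    show "p \<le> j \<and> count_list ps (Some j) < count_list u j" using R by blast
    show "j \<le> i" if "p \<le> i \<and> count_list ps (Some i) < count_list u i" for i
      using R that by (meson leD not_le_imp_less)
  qed
  then show "first_spot u ps p = Some j"
    using R unfolding first_spot_def by auto
qed

lemma parking_snoc:
  "parking u (a @ [p]) = parking u a @ [first_spot u (parking u a) p]"
  by (simp add: parking_def)

lemma length_parking [simp]: "length (parking u a) = length a"
  by (induction a rule: rev_induct) (auto simp: parking_snoc, simp add: parking_def)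

lemma parking_nth:
  "c < length a \<Longrightarrow> parking u a ! c = first_spot u (take c (parking u a)) (a ! c)"
proof (induction a rule: rev_induct)
  case Nil
  then show ?case by simp
next
  case (snoc p a)
  then show ?case
    by (cases "c = length a") (auto simp: parking_snoc nth_append)
qed

lemma parking_eqI:
  assumes "length w = length a"
    and "\<And>c. c < length a \<Longrightarrow> first_spot u (map Some (take c w)) (a ! c) = Some (w ! c)"
  shows "parking u a = map Some w"
  using assms
proof (induction a arbitrary: w rule: rev_induct)
  case Nil
  then show ?case by (simp add: parking_def)
next
  case (snoc p a)
  from snoc.prems(1) obtain v x where w: "w = v @ [x]" and len: "length v = length a"
    by (cases w rule: rev_cases) auto
  have "parking u a = map Some v"
  proof (rule snoc.IH[OF len])
    fix c assume "c < length a"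
    then show "first_spot u (map Some (take c v)) (a ! c) = Some (v ! c)"
      using snoc.prems(2)[of c] w len by (simp add: nth_append)
  qed
  moreover have "first_spot u (map Some v) p = Some x"
    using snoc.prems(2)[of "length a"] w len by (simp add: nth_append)
  ultimately show ?case
    by (simp add: parking_snoc w)
qed

lemma parking_within_capacity: "count_list (parking u a) (Some j) \<le> count_list u j"
proof (induction a rule: rev_induct)
  case Nil
  then show ?case by (simp add: parking_def)
next
  case (snoc p a)
  show ?case
  proof (cases "first_spot u (parking u a) p = Some j")
    case True
    then have "count_list (parking u a) (Some j) < count_list u j"
      by (simp add: first_spot_eq_Some_iff)
    then show ?thesis by (simp add: parking_snoc True)
  next
    case False
    then show ?thesis using snoc.IH by (simp add: parking_snoc)
  qed
qed

lemma count_list_map_Some [simp]: "count_list (map Some w) (Some j) = count_list w j"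
  by (simp add: count_list_map_conv)

lemma count_list_take_less:
  assumes "c < length w" shows "count_list (take c w) (w ! c) < count_list w (w ! c)"
proof -
  have "w = take c w @ w ! c # drop (Suc c) w"
    using assms by (simp add: id_take_nth_drop)
  then have "count_list w (w ! c) = count_list (take c w @ w ! c # drop (Suc c) w) (w ! c)"
    by simp
  then show ?thesis by simp
qed

lemma count_list_take_full_iff:
  "count_list w x \<le> count_list (take c w) x \<longleftrightarrow> (\<forall>p<length w. w ! p = x \<longrightarrow> p < c)"
proof -
  have "count_list w x = count_list (take c w) x + count_list (drop c w) x"
    by (metis append_take_drop_id count_list_append)
  then have "count_list w x \<le> count_list (take c w) x \<longleftrightarrow> x \<notin> set (drop c w)"
    by (auto simp: count_list_0_iff)
  also have "\<dots> \<longleftrightarrow> (\<forall>p<length w. w ! p = x \<longrightarrow> p < c)"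
  proof
    assume *: "x \<notin> set (drop c w)"
    show "\<forall>p<length w. w ! p = x \<longrightarrow> p < c"
    proof (intro allI impI, rule ccontr)
      fix p assume p: "p < length w" "w ! p = x" "\<not> p < c"
      then have "drop c w ! (p - c) = x" "p - c < length (drop c w)" by auto
      then show False using * nth_mem by metis
    qed
  next
    assume *: "\<forall>p<length w. w ! p = x \<longrightarrow> p < c"
    show "x \<notin> set (drop c w)"
    proof
      assume "x \<in> set (drop c w)"
      then obtain i where "i < length w - c" "w ! (c + i) = x"
        by (auto simp: in_set_conv_nth)
      then show False using *[rule_format, of "c + i"] by linarith
    qed
  qed
  finally show ?thesis .
qed

lemma is_parking_function_iff:
  "is_parking_function u a \<longleftrightarrow> length a = length u \<and> (\<forall>p\<in>set a. p \<ge> 1) \<and>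
     (\<exists>w. parking u a = map Some w)"
proof -
  have "(\<forall>c\<in>{1..length u}. spot_of u a c \<noteq> None) \<longleftrightarrow> (\<exists>w. parking u a = map Some w)"
    if len: "length a = length u"
  proof
    assume *: "\<forall>c\<in>{1..length u}. spot_of u a c \<noteq> None"
    have "parking u a = map Some (map the (parking u a))"
    proof (rule nth_equalityI)
      fix i assume "i < length (parking u a)"
      then show "parking u a ! i = map Some (map the (parking u a)) ! i"
        using *[rule_format, of "Suc i"] len by (auto simp: spot_of_def)
    qed simp
    then show "\<exists>w. parking u a = map Some w" ..
  next
    assume "\<exists>w. parking u a = map Some w"
    then obtain w where w: "parking u a = map Some w" ..
    then have "length w = length u"
      using len length_parking[of u a] by (metis length_map)
    then show "\<forall>c\<in>{1..length u}. spot_of u a c \<noteq> None"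
      using w by (auto simp: spot_of_def)
  qed
  then show ?thesis
    unfolding is_parking_function_def by blast
qed

lemma lucky_spots_parked:
  assumes "parking u a = map Some w" "length a = length u"
  shows "lucky_spots u a = {w ! c | c. c < length u \<and> w ! c = a ! c}"
proof -
  have len: "length w = length u"
    using assms length_parking[of u a] by (metis length_map)
  have "spot_of u a (Suc c) = Some (w ! c)" if "c < length u" for c
    using that len assms(1) by (simp add: spot_of_def)
  then have lucky: "lucky_car u a (Suc c) \<longleftrightarrow> w ! c = a ! c" if "c < length u" for c
    using that by (simp add: lucky_car_def)
  show ?thesis
  proof (intro set_eqI iffI)
    fix x assume "x \<in> lucky_spots u a"
    then obtain c where c: "x = a ! (c - 1)" "c \<in> {1..length u}" "lucky_car u a c"
      by (auto simp: lucky_spots_def)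
    then have "c - 1 < length u" "Suc (c - 1) = c" by auto
    then have "c - 1 < length u \<and> w ! (c - 1) = a ! (c - 1) \<and> x = w ! (c - 1)"
      using c lucky[of "c - 1"] by simp
    then show "x \<in> {w ! c | c. c < length u \<and> w ! c = a ! c}"
      by blast
  next
    fix x assume "x \<in> {w ! c | c. c < length u \<and> w ! c = a ! c}"
    then obtain c where "x = a ! (Suc c - 1)" "Suc c \<in> {1..length u}" "lucky_car u a (Suc c)"
      using lucky by auto
    then show "x \<in> lucky_spots u a"
      unfolding lucky_spots_def by blast
  qed
qed

text \<open>
  Since \<open>w\<close> is a rearrangement of \<open>u\<close>, only pairs of neighbouring spots that are both available are
  constrained.
\<close>
definition admissible :: "nat list \<Rightarrow> nat set \<Rightarrow> nat list \<Rightarrow> bool" where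
  "admissible u L w \<longleftrightarrow> mset w = mset u \<and>
     (\<forall>p<length w. \<forall>q<length w. w ! q = Suc (w ! p) \<longrightarrow> w ! q \<notin> L \<longrightarrow> p < q)"

text \<open>
  No spot is used beyond its capacity, and there are as many cars as places.
\<close>
lemma parked_word_mset:
  assumes "parking u a = map Some w" "length a = length u"
  shows "mset w = mset u"
proof -
  have "count_list w j \<le> count_list u j" for j
    using parking_within_capacity[of u a j] assms(1) by simp
  then have "mset w \<subseteq># mset u"
    by (simp add: subseteq_mset_def count_mset)
  moreover have "size (mset w) = size (mset u)"
    using assms length_parking[of u a] by (metis length_map size_mset)
  ultimately show ?thesis
    by (metis mset_subset_size less_irrefl subset_mset.le_imp_less_or_eq)
qed

text \<open>
  The car at index \<open>q\<close> is unlucky, so it passed the spot before its own; that spot was then full, and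
  all the cars that park there had come before it.
\<close>
lemma parked_word_admissible:
  assumes "parking u a = map Some w" "length a = length u"
  shows "admissible u (lucky_spots u a) w"
proof -
  have m: "mset w = mset u"
    using parked_word_mset[OF assms] .
  have len: "length w = length u"
    using m by (metis size_mset)
  have cnt: "count_list w j = count_list u j" for j
    using m by (metis count_mset)
  have "p < q" if p: "p < length w" and q: "q < length w" and s: "w ! q = Suc (w ! p)"
    and notL: "w ! q \<notin> lucky_spots u a" for p q
  proof -
    have "first_spot u (map Some (take q w)) (a ! q) = Some (w ! q)"
      using parking_nth[of q a u] q len assms by (simp add: take_map)
    then have le: "a ! q \<le> w ! q"
      and full: "\<And>i. a ! q \<le> i \<Longrightarrow> i < w ! q \<Longrightarrow> count_list u i \<le> count_list (take q w) i"
      by (auto simp: first_spot_eq_Some_iff)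
    have "a ! q \<noteq> w ! q"
      using notL lucky_spots_parked[OF assms] q len by auto
    then have "count_list w (w ! p) \<le> count_list (take q w) (w ! p)"
      using full[of "w ! p"] le s cnt by simp
    then show ?thesis
      using p by (simp add: count_list_take_full_iff)
  qed
  then show ?thesis
    unfolding admissible_def using m by blast
qed

text \<open>
  Stepping back by one spot makes a car unlucky. It still ends up where it should, because the
  spot that it prefers is unavailable or, by admissibility, already full. The preference is
  positive because spot \<open>1\<close> is lucky whenever it is available.
\<close>
lemma admissible_word_parked:
  assumes adm: "admissible u L w" and pos: "\<forall>x\<in>set u. x \<ge> 1" and L: "L \<subseteq> set u"
    and one: "1 \<in> set u \<Longrightarrow> 1 \<in> L"
  defines "a \<equiv> map (\<lambda>x. if x \<in> L then x else x - 1) w"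
  shows "is_parking_function u a \<and> lucky_spots u a = L \<and> parking u a = map Some w"
proof -
  have m: "mset w = mset u"
    using adm by (simp add: admissible_def)
  have len: "length w = length u" and set: "set w = set u"
    using m by (metis size_mset, metis set_mset_mset)
  have cnt: "count_list w j = count_list u j" for j
    using m by (metis count_mset)
  have big: "x \<ge> 2" if "x \<in> set u" "x \<notin> L" for x
    using that pos one by (metis Suc_1 Suc_leI le_neq_implies_less)
  have park: "parking u a = map Some w"
  proof (rule parking_eqI)
    show "length w = length a" by (simp add: a_def)
    fix c assume "c < length a"
    then have c: "c < length w" by (simp add: a_def)
    then have wc: "w ! c \<in> set u" using set nth_mem by blast
    have room: "count_list (take c w) (w ! c) < count_list u (w ! c)"
      using count_list_take_less[OF c] cnt by simp
    show "first_spot u (map Some (take c w)) (a ! c) = Some (w ! c)"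
    proof (cases "w ! c \<in> L")
      case True
      then have "a ! c = w ! c" using c by (simp add: a_def)
      then show ?thesis using room by (simp add: first_spot_eq_Some_iff)
    next
      case False
      then have ac: "a ! c = w ! c - 1" and two: "w ! c \<ge> 2"
        using c big[OF wc] by (auto simp: a_def)
      have "p < c" if "p < length w" "w ! p = w ! c - 1" for p
      proof -
        have "w ! c = Suc (w ! p)" using that(2) two by linarith
        then show ?thesis using adm c False that(1) unfolding admissible_def by blast
      qed
      then have "count_list u (w ! c - 1) \<le> count_list (take c w) (w ! c - 1)"
        using count_list_take_full_iff[of w "w ! c - 1" c] cnt by simp
      moreover have "i = w ! c - 1" if "w ! c - 1 \<le> i" "i < w ! c" for i
        using that by linarith
      ultimately have "\<forall>i. w ! c - 1 \<le> i \<and> i < w ! c \<longrightarrow> count_list u i \<le> count_list (take c w) i"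
        by metis
      then show ?thesis
        using room unfolding first_spot_eq_Some_iff ac count_list_map_Some by simp
    qed
  qed
  have "\<forall>p\<in>set a. p \<ge> 1"
    using big pos set unfolding a_def by fastforce
  then have pf: "is_parking_function u a"
    unfolding is_parking_function_iff using park len by (auto simp: a_def)
  have "w ! c = a ! c \<longleftrightarrow> w ! c \<in> L" if "c < length u" for c
  proof -
    have "w ! c \<ge> 1" using that len pos set nth_mem by metis
    then show ?thesis using that len by (auto simp: a_def)
  qed
  then have "lucky_spots u a = {w ! c | c. c < length u \<and> w ! c \<in> L}"
    using lucky_spots_parked[OF park] len by (auto simp: a_def)
  also have "\<dots> = set w \<inter> L"
    using len by (auto simp: in_set_conv_nth)
  also have "\<dots> = L"
    using L set by blast
  finally show ?thesis using pf park by blast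
qed

lemma one_lucky:
  assumes "is_parking_function u a" "1 \<in> set u" "\<forall>x\<in>set u. x \<ge> 1"
  shows "1 \<in> lucky_spots u a"
proof -
  obtain w where w: "parking u a = map Some w" and len: "length a = length u"
    and pos: "\<forall>p\<in>set a. p \<ge> 1"
    using assms(1) by (auto simp: is_parking_function_iff)
  have "set w = set u"
    using parked_word_mset[OF w len] by (metis set_mset_mset)
  then obtain c where c: "c < length w" "w ! c = 1"
    using assms(2) by (metis in_set_conv_nth)
  then have c': "c < length a"
    using w length_parking[of u a] by simp
  then have "a ! c \<le> 1"
    using parking_nth[OF c', of u] w c
      first_spot_eq_Some_iff[of u "take c (map Some w)" "a ! c" "w ! c"] by simp
  moreover have "a ! c \<ge> 1"
    using pos c' by auto
  ultimately show ?thesis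
    using c c' len by (auto simp: lucky_spots_parked[OF w len] intro!: exI[of _ c])
qed

definition word_outcome :: "nat list \<Rightarrow> nat list \<Rightarrow> nat set option list" where
  "word_outcome u w =
     map (\<lambda>i. if count_list u i > 0 then Some {c \<in> {1..length u}. w ! (c - 1) = i} else None)
       [1..<Suc (Max (set u))]"

lemma outcome_parked:
  assumes "parking u a = map Some w" "length a = length u"
  shows "outcome u a = word_outcome u w"
proof -
  have len: "length w = length u"
    using assms length_parking[of u a] by (metis length_map)
  have "spot_of u a c = Some (w ! (c - 1))" if "c \<in> {1..length u}" for c
    using that len assms(1) by (auto simp: spot_of_def)
  then show ?thesis
    by (auto simp: outcome_def word_outcome_def)
qed

lemma word_outcome_inj:
  assumes pos: "\<forall>x\<in>set u. x \<ge> 1" and mw: "mset w = mset u" and mv: "mset v = mset u"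
    and eq: "word_outcome u w = word_outcome u v"
  shows "w = v"
proof (rule nth_equalityI)
  show "length w = length v" using mw mv by (metis size_mset)
  fix c assume c: "c < length w"
  have len: "length w = length u" and sw: "set w = set u"
    using mw by (metis size_mset, metis set_mset_mset)
  define i where "i = w ! c"
  have i: "i \<in> set u"
    using c sw nth_mem unfolding i_def by blast
  then have "count_list u i > 0"
    by (metis count_list_0_iff gr0I)
  moreover have "i \<in> set [1..<Suc (Max (set u))]"
    using i pos by (simp add: less_Suc_eq_le Max_ge del: upt_Suc)
  moreover have "\<forall>i\<in>set [1..<Suc (Max (set u))].
      (if count_list u i > 0 then Some {c \<in> {1..length u}. w ! (c - 1) = i} else None)
    = (if count_list u i > 0 then Some {c \<in> {1..length u}. v ! (c - 1) = i} else None)"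
    using eq unfolding word_outcome_def map_eq_conv .
  ultimately have "Some {c \<in> {1..length u}. w ! (c - 1) = i} = Some {c \<in> {1..length u}. v ! (c - 1) = i}"
    by (metis (no_types, lifting))
  then have "{c \<in> {1..length u}. w ! (c - 1) = i} = {c \<in> {1..length u}. v ! (c - 1) = i}"
    by (rule option.inject[THEN iffD1])
  moreover have "Suc c \<in> {c \<in> {1..length u}. w ! (c - 1) = i}"
    using c len by (simp add: i_def)
  ultimately have "Suc c \<in> {c \<in> {1..length u}. v ! (c - 1) = i}"
    by blast
  then show "w ! c = v ! c"
    by (simp add: i_def)
qed

theorem card_outcomes_eq_card_admissible:
  assumes pos: "\<forall>x\<in>set u. x \<ge> 1" and L: "L \<subseteq> set u" and one: "1 \<in> set u \<Longrightarrow> 1 \<in> L"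
  shows "card {outcome u a | a. is_parking_function u a \<and> lucky_spots u a = L}
    = card {w. admissible u L w}"
proof -
  have "{outcome u a | a. is_parking_function u a \<and> lucky_spots u a = L}
    = word_outcome u ` {w. admissible u L w}" (is "?O = _")
  proof (intro equalityI subsetI)
    fix x assume "x \<in> ?O"
    then obtain a w where x: "x = outcome u a" and a: "lucky_spots u a = L" "length a = length u"
      and w: "parking u a = map Some w"
      by (auto simp: is_parking_function_iff)
    then show "x \<in> word_outcome u ` {w. admissible u L w}"
      using outcome_parked[OF w a(2)] parked_word_admissible[OF w a(2)] by auto
  next
    fix x assume "x \<in> word_outcome u ` {w. admissible u L w}"
    then obtain w where x: "x = word_outcome u w" and w: "admissible u L w"
      by auto
    obtain a where a: "is_parking_function u a" "lucky_spots u a = L" "parking u a = map Some w"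
      using admissible_word_parked[OF w pos L one] by blast
    then have "outcome u a = x"
      using outcome_parked[OF a(3)] x by (simp add: is_parking_function_def)
    then show "x \<in> ?O" using a by blast
  qed
  moreover have "inj_on (word_outcome u) {w. admissible u L w}"
    using word_outcome_inj[OF pos] by (auto simp: inj_on_def admissible_def)
  ultimately show ?thesis
    by (simp add: card_image)
qed

section \<open>Admissible words are sorted between consecutive bars\<close>

text \<open>
  The number of bars to the left of the letters \<open>x\<close> of \<open>u\<close>, computed from values instead of positions.
  The three terms stem from the three rules that place bars; the bar to the left of \<open>l\<close> counts
  already for \<open>x = l\<close>, the one to the right of \<open>i\<close> only for larger letters.
\<close>
definition bars_left :: "nat list \<Rightarrow> nat set \<Rightarrow> nat \<Rightarrow> nat" where
  "bars_left u L x =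
     Suc (card {i \<in> set u. Suc i \<notin> set u \<and> i < x} + card {l \<in> L. 1 < l \<and> l \<le> x})"

lemma bars_left_mono:
  assumes "finite L" "x \<le> y" shows "bars_left u L x \<le> bars_left u L y"
  unfolding bars_left_def using assms
  by (intro Suc_le_mono[THEN iffD2] add_mono card_mono) auto

lemma bars_left_Suc_eq:
  assumes "Suc x \<in> set u" "Suc x \<notin> L"
  shows "bars_left u L (Suc x) = bars_left u L x"
proof -
  have "{i \<in> set u. Suc i \<notin> set u \<and> i < Suc x} = {i \<in> set u. Suc i \<notin> set u \<and> i < x}"
    using assms(1) by (auto simp: less_Suc_eq)
  moreover have "{l \<in> L. 1 < l \<and> l \<le> Suc x} = {l \<in> L. 1 < l \<and> l \<le> x}"
    using assms(2) by (auto simp: le_Suc_eq)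
  ultimately show ?thesis by (simp add: bars_left_def)
qed

lemma bars_left_less_Suc:
  assumes fin: "finite L" and x: "x \<in> set u" "x \<ge> 1" and new: "Suc x \<notin> set u \<or> Suc x \<in> L"
  shows "bars_left u L x < bars_left u L (Suc x)"
proof -
  let ?A = "\<lambda>x. {i \<in> set u. Suc i \<notin> set u \<and> i < x}" and ?B = "\<lambda>x. {l \<in> L. 1 < l \<and> l \<le> x}"
  have le: "card (?A x) \<le> card (?A (Suc x))" "card (?B x) \<le> card (?B (Suc x))"
    using fin by (auto intro!: card_mono)
  show ?thesis
    using new
  proof
    assume "Suc x \<notin> set u"
    then have "x \<in> ?A (Suc x)" using x by simp
    moreover have "x \<notin> ?A x" "?A x \<subseteq> ?A (Suc x)" by auto
    ultimately have "?A x \<subset> ?A (Suc x)" by blast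
    then have "card (?A x) < card (?A (Suc x))"
      by (intro psubset_card_mono) simp_all
    then show ?thesis using le by (simp add: bars_left_def)
  next
    assume "Suc x \<in> L"
    then have "Suc x \<in> ?B (Suc x)" using x by simp
    moreover have "Suc x \<notin> ?B x" "?B x \<subseteq> ?B (Suc x)" by auto
    ultimately have "?B x \<subset> ?B (Suc x)" by blast
    then have "card (?B x) < card (?B (Suc x))"
      using fin by (intro psubset_card_mono) simp_all
    then show ?thesis using le by (simp add: bars_left_def)
  qed
qed

text \<open>
  The function \<open>bars_left\<close> is weakly increasing and jumps wherever the next value is missing from
  \<open>u\<close> or lies in \<open>L\<close>. If it agrees at two values, there is no such jump between them.
\<close>
lemma bars_left_eq_run:
  assumes fin: "finite L" and pos: "\<forall>x\<in>set u. x \<ge> 1"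
    and x: "x \<in> set u" and eq: "bars_left u L x = bars_left u L z"
    and m: "x \<le> m" "m < z"
  shows "m \<in> set u \<and> Suc m \<in> set u \<and> Suc m \<notin> L"
proof -
  have run_on: "Suc m \<in> set u \<and> Suc m \<notin> L" if "m \<in> set u" "x \<le> m" "m < z" for m
  proof (rule ccontr)
    assume "\<not> (Suc m \<in> set u \<and> Suc m \<notin> L)"
    then have "bars_left u L m < bars_left u L (Suc m)"
      using bars_left_less_Suc[OF fin that(1)] pos that(1) by blast
    moreover have "bars_left u L x \<le> bars_left u L m" "bars_left u L (Suc m) \<le> bars_left u L z"
      using bars_left_mono[OF fin] that by auto
    ultimately show False using eq by linarith
  qed
  have "m \<in> set u"
    using m
  proof (induction m rule: dec_induct)
    case base
    then show ?case using x by simp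
  next
    case (step k)
    then show ?case using run_on[of k] by simp
  qed
  then show ?thesis using run_on m by blast
qed

text \<open>
  Admissibility orders only neighbouring values. Two letters of the same class are joined by a chain
  of values that occur in \<open>u\<close>, hence in \<open>w\<close>, and the precedences along the chain compose.
\<close>
lemma admissible_iff_sorted_classes:
  assumes fin: "finite L" and pos: "\<forall>x\<in>set u. x \<ge> 1"
  shows "admissible u L w \<longleftrightarrow>
    mset w = mset u \<and> (\<forall>c. sorted (filter (\<lambda>x. bars_left u L x = c) w))"
proof (cases "mset w = mset u")
  case False
  then show ?thesis by (simp add: admissible_def)
next
  case True
  then have set: "set w = set u" by (metis set_mset_mset)
  let ?g = "bars_left u L"
  show ?thesis
  proof
    assume adm: "admissible u L w"
    have "w ! p \<le> w ! q" if q: "q < length w" and pq: "p < q" and eq: "?g (w ! p) = ?g (w ! q)" for p q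
    proof (rule ccontr)
      assume "\<not> w ! p \<le> w ! q"
      then have less: "w ! q < w ! p" by simp
      have uq: "w ! q \<in> set u" using q set nth_mem by blast
      \<comment> \<open>Climbing from the value at \<open>q\<close> to the one at \<open>p\<close>: every occurrence of \<open>m\<close> lies after \<open>q\<close>.\<close>
      have "\<forall>r<length w. w ! r = m \<longrightarrow> q < r" if "Suc (w ! q) \<le> m" "m \<le> w ! p" for m
        using that
      proof (induction m rule: dec_induct)
        case base
        have "Suc (w ! q) \<notin> L"
          using bars_left_eq_run[OF fin pos uq eq[symmetric], of "w ! q"] less by simp
        then show ?case
          using adm q unfolding admissible_def by metis
      next
        case (step m)
        have m: "m \<in> set w" "Suc m \<notin> L"
          using bars_left_eq_run[OF fin pos uq eq[symmetric], of m] step set by auto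
        then obtain s where s: "s < length w" "w ! s = m" by (metis in_set_conv_nth)
        then have "q < s" using step by simp
        then show ?case
          using adm s m(2) unfolding admissible_def by (metis less_trans)
      qed
      from this[of "w ! p"] have "q < p" using less pq q by simp
      then show False using pq by simp
    qed
    then show "mset w = mset u \<and> (\<forall>c. sorted (filter (\<lambda>x. ?g x = c) w))"
      using True by (simp add: sorted_filter_iff_nth)
  next
    assume "mset w = mset u \<and> (\<forall>c. sorted (filter (\<lambda>x. ?g x = c) w))"
    then have srt: "w ! p \<le> w ! q" if "q < length w" "p < q" "?g (w ! p) = ?g (w ! q)" for p q
      using that by (simp add: sorted_filter_iff_nth)
    have "p < q" if p: "p < length w" and q: "q < length w"
      and s: "w ! q = Suc (w ! p)" "w ! q \<notin> L" for p q
    proof (rule ccontr)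
      assume "\<not> p < q"
      then have "q < p" using s(1) by (metis n_not_Suc_n nat_neq_iff)
      moreover have "Suc (w ! p) \<in> set u" using s(1) q set nth_mem by metis
      then have "?g (w ! q) = ?g (w ! p)"
        using bars_left_Suc_eq s by simp
      ultimately show False using srt[of p q] p s(1) by simp
    qed
    then show "admissible u L w" using True by (simp add: admissible_def)
  qed
qed

section \<open>Gaps between bars\<close>

text \<open>
  Classifying positions by the number of bars at or before them cuts them into the gaps between
  consecutive bars. The statement allows repeated bars, for which the gap is empty.
\<close>
lemma card_less_eq_iff_between:
  fixes bs :: "nat list"
  assumes "sorted bs" "Suc i < length bs"
  shows "length (filter (\<lambda>b. b \<le> j) bs) = Suc i \<longleftrightarrow> bs ! i \<le> j \<and> j < bs ! Suc i"
proof -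
  let ?S = "{k. k < length bs \<and> bs ! k \<le> j}"
  have len: "length (filter (\<lambda>b. b \<le> j) bs) = card ?S"
    by (rule length_filter_conv_card)
  have mono: "bs ! k \<le> bs ! k'" if "k \<le> k'" "k' < length bs" for k k'
    using assms(1) that by (simp add: sorted_nth_mono)
  show ?thesis
  proof
    assume c: "length (filter (\<lambda>b. b \<le> j) bs) = Suc i"
    have "bs ! i \<le> j"
    proof (rule ccontr)
      assume "\<not> bs ! i \<le> j"
      then have "?S \<subseteq> {..<i}"
        using mono[of i] by (auto simp: not_le) (meson leD le_less_linear order_less_le_trans)
      then have "card ?S \<le> i" using card_mono[of "{..<i}" ?S] by simp
      then show False using c len by simp
    qed
    moreover have "j < bs ! Suc i"
    proof (rule ccontr)
      assume "\<not> j < bs ! Suc i"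
      then have "{..Suc i} \<subseteq> ?S"
        using mono[of _ "Suc i"] assms(2) by (fastforce intro: order_trans[of _ "bs ! Suc i"])
      then have "Suc (Suc i) \<le> card ?S" using card_mono[of ?S "{..Suc i}"] by simp
      then show False using c len by simp
    qed
    ultimately show "bs ! i \<le> j \<and> j < bs ! Suc i" ..
  next
    assume b: "bs ! i \<le> j \<and> j < bs ! Suc i"
    have "?S = {..<Suc i}"
    proof (intro equalityI subsetI)
      fix k assume "k \<in> ?S"
      then show "k \<in> {..<Suc i}"
        using mono[of "Suc i" k] b by (cases "Suc i \<le> k") auto
    next
      fix k assume "k \<in> {..<Suc i}"
      then show "k \<in> ?S"
        using mono[of k i] b assms(2) by auto
    qed
    then show "length (filter (\<lambda>b. b \<le> j) bs) = Suc i" using len by simp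
  qed
qed

lemma greatest_occurrence_less_iff:
  fixes u :: "'a::linorder list"
  assumes "sorted u" "x \<in> set u" "j < length u"
  shows "(GREATEST j. j < length u \<and> u ! j = x) < j \<longleftrightarrow> x < u ! j"
proof -
  let ?P = "\<lambda>j. j < length u \<and> u ! j = x" and ?G = "GREATEST j. j < length u \<and> u ! j = x"
  have bound: "\<And>k. ?P k \<Longrightarrow> k \<le> length u" by simp
  have G: "?P ?G"
  proof -
    obtain k where k: "?P k" using assms(2) by (auto simp: in_set_conv_nth)
    show ?thesis using GreatestI_nat[of ?P k, OF k bound] .
  qed
  have le_G: "k \<le> ?G" if "?P k" for k
    using Greatest_le_nat[of ?P k, OF that bound] .
  show ?thesis
  proof
    assume "?G < j"
    then have "x \<le> u ! j" "u ! j \<noteq> x"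
      using G le_G[of j] assms(3) sorted_nth_mono[OF assms(1), of ?G j] by auto
    then show "x < u ! j" by simp
  next
    assume "x < u ! j"
    then show "?G < j"
      using G sorted_nth_mono[OF assms(1), of j ?G] by (metis leD not_le_imp_less)
  qed
qed

lemma least_occurrence_le_iff:
  fixes u :: "'a::linorder list"
  assumes "sorted u" "x \<in> set u" "j < length u"
  shows "(LEAST j. j < length u \<and> u ! j = x) \<le> j \<longleftrightarrow> x \<le> u ! j"
proof -
  let ?P = "\<lambda>j. j < length u \<and> u ! j = x" and ?F = "LEAST j. j < length u \<and> u ! j = x"
  have F: "?P ?F"
    using assms(2) by (metis (mono_tags, lifting) LeastI_ex in_set_conv_nth)
  show ?thesis
  proof
    assume "?F \<le> j"
    then show "x \<le> u ! j"
      using F sorted_nth_mono[OF assms(1), of ?F j] assms(3) by metis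
  next
    assume x: "x \<le> u ! j"
    show "?F \<le> j"
    proof (rule ccontr)
      assume "\<not> ?F \<le> j"
      then have "u ! j \<le> x" "\<not> ?P j"
        using F sorted_nth_mono[OF assms(1), of j ?F] not_less_Least[of j ?P] by auto
      then show False using x assms(3) by simp
    qed
  qed
qed

text \<open>
  This links the two descriptions of the bars: \<open>bars\<close> lists their positions, while \<open>bars_left\<close> looks only at the
  value of a letter. Since \<open>u\<close> is sorted, comparing a position with the first or last occurrence of
  a value amounts to comparing values.
\<close>
lemma size_bars_le:
  assumes sorted: "sorted u" and pos: "\<forall>x\<in>set u. x \<ge> 1" and L: "L \<subseteq> set u" and j: "j < length u"
  shows "size {#b \<in># bars u L. b \<le> j#} = bars_left u L (u ! j)"
proof -
  let ?G = "\<lambda>i. Suc (GREATEST j. j < length u \<and> u ! j = i)"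
  let ?F = "\<lambda>l. LEAST j. j < length u \<and> u ! j = l"
  let ?A = "{i \<in> {1..Max (set u)}. i \<in> set u \<and> Suc i \<notin> set u}" and ?B = "{l \<in> L. l > 1}"
  have fin: "finite L" using L finite_subset by blast
  have A: "{i \<in> ?A. ?G i \<le> j} = {i \<in> set u. Suc i \<notin> set u \<and> i < u ! j}"
    using greatest_occurrence_less_iff[OF sorted _ j] pos by (auto simp: Suc_le_eq)
  have B: "{l \<in> ?B. ?F l \<le> j} = {l \<in> L. 1 < l \<and> l \<le> u ! j}"
    using least_occurrence_le_iff[OF sorted _ j] L by blast
  have "size {#b \<in># bars u L. b \<le> j#} =
      Suc (card {i \<in> ?A. ?G i \<le> j} + card {l \<in> ?B. ?F l \<le> j})"
    using fin by (simp add: bars_def filter_mset_image_mset filter_mset_mset_set)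
  then show ?thesis unfolding A B bars_left_def .
qed

section \<open>The number of bars\<close>

text \<open>
  A block is determined by the spot \<open>e\<close> just before it, with \<open>e = 0\<close> for a block that starts at
  spot \<open>1\<close>. Given \<open>e\<close>, the block extends to the spot before the next available one, which exists
  because the maximum of \<open>u\<close> is available.
\<close>
lemma card_unavailable_blocks:
  assumes ne: "u \<noteq> []"
  shows "card (unavailable_blocks u)
    = card {e. e < Max (set u) \<and> (e = 0 \<or> e \<in> set u) \<and> Suc e \<notin> set u}" (is "_ = card ?E")
proof -
  let ?M = "Max (set u)"
  define nxt where "nxt e = (LEAST t. e < t \<and> t \<in> set u)" for e
  define F where "F e = {Suc e..nxt e - 1}" for e
  have M: "?M \<in> set u" using ne by simp
  have interval: "unavailable_interval u B \<longleftrightarrow>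
      (\<exists>i j. 1 \<le> i \<and> i \<le> j \<and> j \<le> ?M \<and> B = {i..j}) \<and> B \<inter> set u = {}" for B
    unfolding unavailable_interval_def count_list_0_iff by blast
  have nxt: "e < nxt e" "nxt e \<in> set u" if "e < ?M" for e
    using LeastI[of "\<lambda>t. e < t \<and> t \<in> set u" ?M] that M by (auto simp: nxt_def)
  have nxt_le: "nxt e \<le> t" if "e < t" "t \<in> set u" for e t
    unfolding nxt_def using that by (intro Least_le) simp
  have F: "Suc e \<le> nxt e - 1" "nxt e - 1 < ?M" "F e \<inter> set u = {}" if "e \<in> ?E" for e
  proof -
    have e: "e < ?M" "Suc e \<notin> set u" using that by auto
    have "nxt e \<noteq> Suc e" using nxt(2)[OF e(1)] e(2) by auto
    then show "Suc e \<le> nxt e - 1" using nxt(1)[OF e(1)] by linarith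
    show "nxt e - 1 < ?M" using nxt_le[OF e(1) M] nxt(1)[OF e(1)] by linarith
    show "F e \<inter> set u = {}"
    proof (rule ccontr)
      assume "F e \<inter> set u \<noteq> {}"
      then obtain t where t: "t \<in> set u" "Suc e \<le> t" "t \<le> nxt e - 1" by (auto simp: F_def)
      then show False using nxt_le[of e t] nxt(1)[OF e(1)] by simp
    qed
  qed
  have block: "unavailable_interval u (F e)" if "e \<in> ?E" for e
    unfolding interval using F[OF that] unfolding F_def by (metis One_nat_def Suc_leI le_add1 less_imp_le plus_1_eq_Suc)
  have "unavailable_blocks u = F ` ?E"
  proof (intro equalityI subsetI)
    fix B assume "B \<in> unavailable_blocks u"
    then have B: "unavailable_interval u B"
      and maximal: "\<And>B'. unavailable_interval u B' \<Longrightarrow> B \<subseteq> B' \<Longrightarrow> B' = B"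
      by (auto simp: unavailable_blocks_def)
    obtain i j where ij: "1 \<le> i" "i \<le> j" "j \<le> ?M" "B = {i..j}" and free: "B \<inter> set u = {}"
      using B unfolding interval by blast
    have e: "i - 1 \<in> ?E"
    proof -
      have "i \<notin> set u" using ij free by auto
      moreover have "i - 1 = 0 \<or> i - 1 \<in> set u"
      proof (rule ccontr)
        assume *: "\<not> (i - 1 = 0 \<or> i - 1 \<in> set u)"
        have ext: "{i - 1..j} = insert (i - 1) B" using ij by auto
        have "unavailable_interval u {i - 1..j}"
          unfolding interval
        proof (intro conjI exI)
          show "1 \<le> i - 1" "i - 1 \<le> j" "j \<le> ?M" "{i - 1..j} = {i - 1..j}" using * ij by auto
          show "{i - 1..j} \<inter> set u = {}" unfolding ext using * free by blast
        qed
        then have "{i - 1..j} = B" using maximal ext by blast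
        moreover have "i - 1 \<notin> B" using ij * by auto
        ultimately show False using ext by blast
      qed
      moreover have "i - 1 < ?M" using ij by linarith
      ultimately show ?thesis using ij(1) by simp
    qed
    \<comment> \<open>\<open>B\<close> cannot cross the next available spot, and by maximality it reaches up to it.\<close>
    have "B \<subseteq> F (i - 1)"
    proof
      fix s assume s: "s \<in> B"
      have "s < nxt (i - 1)"
      proof (rule ccontr)
        assume "\<not> s < nxt (i - 1)"
        moreover have "i - 1 < nxt (i - 1)" "nxt (i - 1) \<in> set u" using nxt e by auto
        ultimately have "nxt (i - 1) \<in> B \<inter> set u" using s ij by auto
        then show False using free by blast
      qed
      then show "s \<in> F (i - 1)" using s ij by (auto simp: F_def)
    qed
    then have "F (i - 1) = B" using maximal block[OF e] by blast
    then show "B \<in> F ` ?E" using e by blast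
  next
    fix B assume "B \<in> F ` ?E"
    then obtain e where e: "e \<in> ?E" and B: "B = F e" by blast
    have "B' = B" if B': "unavailable_interval u B'" and sub: "B \<subseteq> B'" for B'
    proof -
      obtain i j where ij: "1 \<le> i" "i \<le> j" "j \<le> ?M" "B' = {i..j}" and free: "B' \<inter> set u = {}"
        using B' unfolding interval by blast
      have mem: "Suc e \<in> B'" "nxt e - 1 \<in> B'" using sub B F(1)[OF e] by (auto simp: F_def)
      have nx: "e < nxt e" "nxt e \<in> set u" using nxt e by auto
      have "i = Suc e"
      proof (rule ccontr)
        assume "i \<noteq> Suc e"
        then have "e \<in> B'" "e \<noteq> 0" using mem(1) ij by auto
        then show False using e free by auto
      qed
      moreover have "j = nxt e - 1"
      proof (rule ccontr)
        assume "j \<noteq> nxt e - 1"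
        then have "nxt e \<in> B'" using mem ij nx by auto
        then show False using nx free by auto
      qed
      ultimately show ?thesis using ij B by (simp add: F_def)
    qed
    then show "B \<in> unavailable_blocks u"
      using block[OF e] B by (auto simp: unavailable_blocks_def)
  qed
  moreover have "inj_on F ?E"
  proof (rule inj_onI)
    fix e e' assume e: "e \<in> ?E" "e' \<in> ?E" "F e = F e'"
    have min: "Min (F e) = Suc e" if "e \<in> ?E" for e
      using F(1)[OF that] unfolding F_def by (intro Min_eqI) auto
    from min[OF e(1)] have "Min (F e') = Suc e" unfolding e(3) .
    moreover from min[OF e(2)] have "Min (F e') = Suc e'" .
    ultimately have "Suc e = Suc e'" by (rule trans[OF sym])
    then show "e = e'" by (rule Suc_inject)
  qed
  ultimately show ?thesis by (simp add: card_image)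
qed

text \<open>
  Write \<open>A'\<close> for the occurring values below the maximum whose successor is missing. The second rule gives
  a bar for each of them and one for the maximum. The blocks are counted by \<open>A'\<close>, plus one if \<open>1\<close> does
  not occur; the set \<open>L\<close> contributes a bar for each element, minus one if \<open>1\<close> does occur. The two
  corrections add up to the same number in both cases.
\<close>
lemma size_bars:
  assumes ne: "u \<noteq> []" and pos: "\<forall>x\<in>set u. x \<ge> 1" and L: "L \<subseteq> set u"
    and one: "1 \<in> set u \<Longrightarrow> 1 \<in> L"
  shows "size (bars u L) = Suc (num_parts u L)"
proof -
  let ?M = "Max (set u)"
  let ?A = "{i \<in> {1..?M}. i \<in> set u \<and> Suc i \<notin> set u}" and ?B = "{l \<in> L. l > 1}"
  let ?E = "{e. e < ?M \<and> (e = 0 \<or> e \<in> set u) \<and> Suc e \<notin> set u}"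
  let ?A' = "{e. 0 < e \<and> e < ?M \<and> e \<in> set u \<and> Suc e \<notin> set u}"
  have finL: "finite L" using L finite_subset by blast
  have M: "?M \<in> set u" "?M \<ge> 1" "Suc ?M \<notin> set u"
    using ne pos Max_ge[of "set u" "Suc ?M"] by (auto simp del: Max_ge)
  have "?A = insert ?M ?A'" using M by (auto intro!: le_neq_implies_less Max_ge)
  then have A: "card ?A = Suc (card ?A')" by simp
  have E: "card ?E = card ?A' + (if 1 \<in> set u then 0 else 1)"
  proof (cases "1 \<in> set u")
    case True
    then have "?E = ?A'" using pos by (auto intro: gr0I)
    then show ?thesis using True by simp
  next
    case False
    then have "?E = insert 0 ?A'" using M by auto
    then show ?thesis using False by simp
  qed
  have B: "card L = card ?B + (if 1 \<in> set u then 1 else 0)"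
  proof (cases "1 \<in> set u")
    case True
    then have "L = insert 1 ?B" using one pos L by force
    moreover have "card (insert 1 ?B) = Suc (card ?B)" using finL by simp
    ultimately show ?thesis using True by simp
  next
    case False
    then have "L = ?B" using pos L by (fastforce intro: le_neq_implies_less)
    then show ?thesis using False by simp
  qed
  have "size (bars u L) = Suc (card ?A + card ?B)"
    by (simp add: bars_def)
  also have "\<dots> = Suc (card ?E + card L)" using A E B by simp
  also have "\<dots> = Suc (num_parts u L)"
    using card_unavailable_blocks[OF ne] by (simp add: num_parts_def)
  finally show ?thesis .
qed

text \<open>
  The second rule, applied to the maximum, puts a bar at the right end of the word.
\<close>
lemma length_in_bars:
  assumes ne: "u \<noteq> []" and sorted: "sorted u" and pos: "\<forall>x\<in>set u. x \<ge> 1"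
  shows "length u \<in># bars u L"
proof -
  let ?M = "Max (set u)"
  have M: "?M \<in> set u" "?M \<ge> 1" "Suc ?M \<notin> set u"
    using ne pos Max_ge[of "set u" "Suc ?M"] by (auto simp del: Max_ge)
  obtain i where i: "i < length u" "u ! i = ?M" using M(1) by (metis in_set_conv_nth)
  have "?M \<le> u ! (length u - 1)"
    using sorted_nth_mono[OF sorted, of i "length u - 1"] i by simp
  moreover have "u ! (length u - 1) \<le> ?M" using ne by simp
  ultimately have "u ! (length u - 1) = ?M" by (rule antisym[rotated])
  then have "(GREATEST j. j < length u \<and> u ! j = ?M) = length u - 1"
    using ne by (intro Greatest_equality) auto
  then have "length u = Suc (GREATEST j. j < length u \<and> u ! j = ?M)" using ne by simp
  then show ?thesis using M by (auto simp: bars_def)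
qed

lemma bars_le_length:
  assumes "b \<in># bars u L" and L: "L \<subseteq> set u"
  shows "b \<le> length u"
proof -
  have fin: "finite L" using L finite_subset by blast
  have "(GREATEST j. j < length u \<and> u ! j = x) < length u" if x: "x \<in> set u" for x
  proof -
    obtain k where k: "k < length u \<and> u ! k = x" using x by (auto simp: in_set_conv_nth)
    show ?thesis
      using GreatestI_nat[where P = "\<lambda>j. j < length u \<and> u ! j = x" and k = k and b = "length u"] k by simp
  qed
  moreover have "(LEAST j. j < length u \<and> u ! j = x) < length u" if x: "x \<in> set u" for x
  proof -
    obtain k where k: "k < length u \<and> u ! k = x" using x by (auto simp: in_set_conv_nth)
    show ?thesis
      using LeastI[of "\<lambda>j. j < length u \<and> u ! j = x" k] k by simp
  qed
  ultimately show ?thesis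
    using assms fin by (fastforce simp: bars_def Suc_le_eq intro: less_imp_le)
qed

section \<open>The count\<close>

theorem theorem4p5:
  fixes u :: "nat list" and n :: nat and L :: "nat set"
  assumes "n \<ge> 1" and "length u = n"
    and "sorted u" and "\<forall>x\<in>set u. x \<ge> 1"
    and "L \<subseteq> set u"
    and "\<exists>a. is_parking_function u a \<and> lucky_spots u a = L"
  shows "real (card {outcome u a | a. is_parking_function u a \<and> lucky_spots u a = L})
         = fact n / (\<Prod>\<delta>\<leftarrow>assoc_composition u L. fact \<delta>)"
proof -
  note n = assms(2) and sorted = assms(3) and pos = assms(4) and L = assms(5)
  have ne: "u \<noteq> []" using assms(1) n by auto
  have fin: "finite L" using L finite_subset by blast
  have one: "1 \<in> L" if "1 \<in> set u" using that assms(6) one_lucky pos by blast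
  let ?g = "bars_left u L" and ?k = "num_parts u L"
  let ?C = "image_mset ?g (mset u)"
  define bs where "bs = sorted_list_of_multiset (bars u L)"
  have bs: "mset bs = bars u L" "sorted bs" by (simp_all add: bs_def)
  have len: "length bs = Suc ?k"
    using bs(1) size_bars[OF ne pos L one] by (metis size_mset)
  have "n \<in> set bs" using length_in_bars[OF ne sorted pos] bs(1) n by (metis set_mset_mset)
  then obtain i where "i < length bs" "bs ! i = n" by (metis in_set_conv_nth)
  then have "n \<le> bs ! ?k" using sorted_nth_mono[OF bs(2), of i ?k] len by simp
  have bs_le: "bs ! i \<le> n" if "i \<le> ?k" for i
    using bars_le_length[OF _ L] that len bs(1) n by (metis le_imp_less_Suc nth_mem set_mset_mset)
  then have bsk: "bs ! ?k = n" using \<open>n \<le> bs ! ?k\<close> by (simp add: le_antisym)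

  \<comment> \<open>The classes are numbered from \<open>1\<close>, as the bar at the left end precedes every letter.\<close>
  have g: "?g (u ! j) = length (filter (\<lambda>b. b \<le> j) bs)" if "j < n" for j
    using size_bars_le[OF sorted pos L, of j] that n by (simp flip: bs(1) mset_filter)
  have count: "count ?C (Suc i) = bs ! Suc i - bs ! i" if i: "i < ?k" for i
  proof -
    have "count ?C (Suc i) = count_list (map ?g u) (Suc i)"
      by (metis count_mset mset_map)
    also have "\<dots> = card {j. j < n \<and> ?g (u ! j) = Suc i}"
      by (auto simp: count_list_eq_length_filter length_filter_conv_card n intro: arg_cong[where f = card])
    also have "{j. j < n \<and> ?g (u ! j) = Suc i} = {bs ! i..<bs ! Suc i}"
      using g card_less_eq_iff_between[OF bs(2), of i] i len bs_le[of "Suc i"] by auto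
    finally show ?thesis by simp
  qed
  have range: "set_mset ?C \<subseteq> Suc ` {..<?k}"
  proof
    fix c assume "c \<in> set_mset ?C"
    then obtain j where j: "j < n" "c = ?g (u ! j)" using n by (auto simp: in_set_conv_nth)
    have "c = length (filter (\<lambda>b. b \<le> j) bs)" using g j by simp
    \<comment> \<open>The last bar stands at the right end, so it is not to the left of any letter.\<close>
    moreover have "\<not> bs ! ?k \<le> j" using bsk j by simp
    then have "length (filter (\<lambda>b. b \<le> j) bs) < length bs"
      using len by (intro length_filter_less[of "bs ! ?k"]) auto
    ultimately have "c \<le> ?k" using len by simp
    moreover have "c \<ge> 1" using j by (simp add: bars_left_def)
    ultimately have "c = Suc (c - 1)" "c - 1 < ?k" by auto
    then show "c \<in> Suc ` {..<?k}" by blast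
  qed
  have "(\<Prod>c\<in>set_mset ?C. fact (count ?C c)) = (\<Prod>c\<in>Suc ` {..<?k}. fact (count ?C c) :: nat)"
  proof (rule prod.mono_neutral_left[OF _ range])
    show "\<forall>c\<in>Suc ` {..<?k} - set_mset ?C. fact (count ?C c) = (1 :: nat)"
      by (metis DiffD2 fact_0 not_in_iff)
  qed simp
  also have "\<dots> = (\<Prod>i<?k. fact (count ?C (Suc i)))"
    by (simp add: prod.reindex)
  also have "\<dots> = (\<Prod>i<?k. fact (bs ! Suc i - bs ! i))"
    using count by (intro prod.cong) auto
  finally have parts: "(\<Prod>c\<in>set_mset ?C. fact (count ?C c)) = (\<Prod>i<?k. fact (bs ! Suc i - bs ! i) :: nat)" .
  have comp: "(\<Prod>\<delta>\<leftarrow>assoc_composition u L. fact \<delta>) = (\<Prod>i<?k. fact (bs ! Suc i - bs ! i) :: real)"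
    unfolding assoc_composition_def Let_def bs_def[symmetric]
    by (simp add: prod.distinct_set_conv_list[symmetric] atLeast0LessThan comp_def)

  have "card {outcome u a | a. is_parking_function u a \<and> lucky_spots u a = L}
      = card (permutations_of_multiset ?C)"
    using card_outcomes_eq_card_admissible[OF pos L one] admissible_iff_sorted_classes[OF fin pos]
      card_words_sorted_on_classes[of u ?g] by simp
  moreover have "card (permutations_of_multiset ?C) * (\<Prod>i<?k. fact (bs ! Suc i - bs ! i)) = fact n"
    using card_permutations_of_multiset_aux[of ?C] parts n by simp
  then have "real (card (permutations_of_multiset ?C) * (\<Prod>i<?k. fact (bs ! Suc i - bs ! i))) = fact n"
    by (simp only: of_nat_fact)
  then have "real (card (permutations_of_multiset ?C)) * (\<Prod>i<?k. fact (bs ! Suc i - bs ! i)) = fact n"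
    by simp
  ultimately show ?thesis
    unfolding comp by (simp add: field_simps)
qed

end
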